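(* Let $n\ge 1$ be an integer and let $\mathbf{M}$ be a mean. The following are equivalent: (i) For all positive definite $A\in M_{2n}$, $\mathrm{diag}_{\mathbf{M}}(A)\prec^w\delta(A)$. (ii) For all positive definite $A\in M_{2n}$ with symplectic eigenvalues $\delta_1,\dots,\delta_n$ and all $k=1,\dots,n$, $$\sum_{j=1}^k\delta_j^\uparrow=\min\Big\{\sum_{j=1}^k\mathbf{M}(b_{jj},b_{k+j,k+j}) : [b_{ij}]_{i,j=1}^{2k}\in\mathcal{S}_k(A)\Big\}.$$
   Context: $M_{m,n}$ is the set of $m\times n$ real matrices, $M_n=M_{n,n}$, $I_n$ is the identity matrix and $0_n$ the zero matrix of size $n$. Positive definite matrices are real symmetric positive definite. A (generalized) mean $\mathbf{M}$ is a positive continuous function on $(0,\infty)\times(0,\infty)$ such that for all $a,b>0$: (i) $\mathbf{M}(a,b)=\mathbf{M}(b,a)$; (ii) $\mathbf{M}(ra,rb)=r\mathbf{M}(a,b)$ for all $r>0$; (iii) $\mathbf{M}(a,b)$ is monotone increasing in $a$ and $b$; (iv) if $a\le b$, then $a\le \mathbf{M}(a,b)\le b$. For $A=[a_{ij}]_{i,j=1}^{2n}\in M_{2n}$ with all $a_{ii}>0$, the symplectic diagonal of $A$ associated with $\mathbf{M}$ is the vector $\mathrm{diag}_{\mathbf{M}}(A)=[\mathbf{M}(a_{ii},a_{n+i,n+i})]_{i=1}^n\in\mathbb{R}^n$. Let $J_{2n}=\begin{bmatrix}0_n & I_n\\ -I_n & 0_n\end{bmatrix}$. A matrix $W\in M_{2n}$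 is symplectic if $W^\top J_{2n}W=J_{2n}$. By Williamson's theorem, every positive definite $A\in M_{2n}$ can be written as $A=W(D\oplus D)W^\top$ with $W$ symplectic and $D=\mathrm{diag}(\delta_1,\dots,\delta_n)$ a diagonal matrix with positive diagonal entries, unique up to permutation of its diagonal entries. The numbers $\delta_1,\dots,\delta_n$ (with multiplicity) are the symplectic eigenvalues of $A$, and $\delta(A)=[\delta_j^\uparrow]_{j=1}^n$ is the vector of symplectic eigenvalues in nondecreasing order. For $A\in M_{2n}$ and $1\le k\le n$, $\mathcal{S}_k(A)=\{X^\top AX : X\in M_{2n,2k}\text{ with }X^\top J_{2n}X=J_{2k}\}$. For real $z_1,\dots,z_n$, $z_1^\uparrow\le\cdots\le z_n^\uparrow$ denotes their nondecreasing rearrangement. For $x,y\in\mathbb{R}^n$, $x\prec^w y$ ($x$ is weakly supermajorized by $y$) means $\sum_{j=1}^k x_j^\uparrow\ge\sum_{j=1}^k y_j^\uparrow$ for all $k=1,\dots,n$. *)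

theory Defs
  imports Complex_Main "Jordan_Normal_Form.Matrix"
begin

text \<open>
  Matrices and vectors are those of \<^theory>\<open>Jordan_Normal_Form.Matrix\<close>, indexed from 0: the entry
  \<open>a\<^sub>i\<^sub>j\<close> in the usual notation, with \<open>i, j \<ge> 1\<close>, is \<open>A $$ (i - 1, j - 1)\<close>.
\<close>

text \<open>
  The values of \<open>M\<close> outside \<open>(0,\<infinity>) \<times> (0,\<infinity>)\<close> are unconstrained. ``Increasing'' is not strict,
  so that for instance the minimum and the maximum are means.
\<close>

definition is_mean :: "(real \<Rightarrow> real \<Rightarrow> real) \<Rightarrow> bool" where
  "is_mean M \<longleftrightarrow>
     continuous_on ({0<..} \<times> {0<..}) (\<lambda>(a, b). M a b) \<and>
     (\<forall>a>0. \<forall>b>0. M a b > 0) \<and>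
     (\<forall>a>0. \<forall>b>0. M a b = M b a) \<and>
     (\<forall>a>0. \<forall>b>0. \<forall>r>0. M (r * a) (r * b) = r * M a b) \<and>
     (\<forall>a>0. \<forall>a'>0. \<forall>b>0. a \<le> a' \<longrightarrow> M a b \<le> M a' b) \<and>
     (\<forall>a>0. \<forall>b>0. \<forall>b'>0. b \<le> b' \<longrightarrow> M a b \<le> M a b') \<and>
     (\<forall>a>0. \<forall>b>0. a \<le> b \<longrightarrow> a \<le> M a b \<and> M a b \<le> b)"

definition pos_def_mat :: "nat \<Rightarrow> real mat \<Rightarrow> bool" where
  "pos_def_mat m A \<longleftrightarrow> A \<in> carrier_mat m m \<and> transpose_mat A = A \<and>
     (\<forall>v \<in> carrier_vec m. v \<noteq> 0\<^sub>v m \<longrightarrow> v \<bullet> (A *\<^sub>v v) > 0)"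

definition symp_diag :: "(real \<Rightarrow> real \<Rightarrow> real) \<Rightarrow> nat \<Rightarrow> real mat \<Rightarrow> real vec" where
  "symp_diag M n A = vec n (\<lambda>i. M (A $$ (i, i)) (A $$ (n + i, n + i)))"

text \<open>\<open>J_mat n\<close> is the \<open>2n \<times> 2n\<close> matrix \<open>J\<^sub>2\<^sub>n\<close>; similarly below, \<open>n\<close> is always half the size.\<close>

definition J_mat :: "nat \<Rightarrow> real mat" where
  "J_mat n = four_block_mat (0\<^sub>m n n) (1\<^sub>m n) (- 1\<^sub>m n) (0\<^sub>m n n)"

definition symplectic_mat :: "nat \<Rightarrow> real mat \<Rightarrow> bool" where
  "symplectic_mat n W \<longleftrightarrow>
     W \<in> carrier_mat (2 * n) (2 * n) \<and> transpose_mat W * J_mat n * W = J_mat n"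

definition williamson_form :: "nat \<Rightarrow> real mat \<Rightarrow> real vec \<Rightarrow> bool" where
  "williamson_form n A d \<longleftrightarrow> d \<in> carrier_vec n \<and> (\<forall>i<n. d $ i > 0) \<and>
     (\<exists>W D. symplectic_mat n W \<and> D = mat_diag n (\<lambda>i. d $ i) \<and>
        A = W * four_block_mat D (0\<^sub>m n n) (0\<^sub>m n n) D * transpose_mat W)"

definition incr_rearr :: "real vec \<Rightarrow> real vec" where
  "incr_rearr z = vec_of_list (sort (list_of_vec z))"

text \<open>
  For positive definite \<open>A\<close>, Williamson's theorem says that a \<open>d\<close> as below exists and is unique up to
  permutation of its entries; hence the rearranged vector does not depend on the choice.
\<close>

definition symp_eigvals :: "nat \<Rightarrow> real mat \<Rightarrow> real vec" where
  "symp_eigvals n A = incr_rearr (SOME d. williamson_form n A d)"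

definition symp_compressions :: "nat \<Rightarrow> nat \<Rightarrow> real mat \<Rightarrow> real mat set" where
  "symp_compressions n k A =
     {transpose_mat X * A * X | X. X \<in> carrier_mat (2 * n) (2 * k) \<and>
        transpose_mat X * J_mat n * X = J_mat k}"

definition weak_supermajorized :: "nat \<Rightarrow> real vec \<Rightarrow> real vec \<Rightarrow> bool" where
  "weak_supermajorized n x y \<longleftrightarrow> x \<in> carrier_vec n \<and> y \<in> carrier_vec n \<and>
     (\<forall>k \<in> {1..n}. (\<Sum>j<k. incr_rearr x $ j) \<ge> (\<Sum>j<k. incr_rearr y $ j))"

definition is_minimum :: "real \<Rightarrow> real set \<Rightarrow> bool" where
  "is_minimum m S \<longleftrightarrow> m \<in> S \<and> (\<forall>s \<in> S. m \<le> s)"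

end

theory Submission
  imports Defs "HOL-Analysis.Function_Topology" "Jordan_Normal_Form.Determinant"
begin

text \<open>
  A matrix \<open>X\<close> with \<open>X\<^sup>T J X = J\<close> extends to a symplectic \<open>S\<close>, and \<open>A\<close> and \<open>S\<^sup>T A S\<close> have the same
  symplectic eigenvalues, so supermajorization for \<open>S\<^sup>T A S\<close> bounds the sums over the compressions of
  \<open>A\<close> from below; the columns of a Williamson basis with the smallest eigenvalues attain the bound,
  because \<open>M d d = d\<close>. Conversely, the sums of \<open>k\<close> entries of the symplectic diagonal come from
  compressions to coordinate pairs. Uniqueness of the symplectic eigenvalues is not needed: the sets
  of Williamson forms of \<open>A\<close> and \<open>S\<^sup>T A S\<close> coincide, so the choice operator picks the same vector.

  Williamson's theorem itself follows by splitting off one symplectic pair at a time: on the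
  symplectic complement of the pairs found so far, a maximizer \<open>(u, v)\<close> of
  \<open>\<omega>(u, v)\<^sup>2 / (A(u, u) A(v, v))\<close> is, suitably scaled, an eigenpair
  \<open>A(\<cdot>, u) = d \<omega>(\<cdot>, v)\<close>, \<open>A(\<cdot>, v) = - d \<omega>(\<cdot>, u)\<close> by the first-order condition.
\<close>

section \<open>Bilinear forms\<close>

text \<open>
  Vectors are functions on the naturals of which only the values below \<open>2 * n\<close> matter; they form a
  vector space without carrier conditions, and the product topology makes cubes compact.
\<close>

definition symp_form :: "nat \<Rightarrow> (nat \<Rightarrow> real) \<Rightarrow> (nat \<Rightarrow> real) \<Rightarrow> real" where
  "symp_form n f g = (\<Sum>i<n. f i * g (n + i) - f (n + i) * g i)"

definition mat_form :: "real mat \<Rightarrow> (nat \<Rightarrow> real) \<Rightarrow> (nat \<Rightarrow> real) \<Rightarrow> real" where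
  "mat_form A f g = (\<Sum>i<dim_row A. \<Sum>j<dim_col A. f i * A $$ (i, j) * g j)"

lemma symp_form_linear:
  "symp_form n (\<lambda>a. f a + g a) h = symp_form n f h + symp_form n g h"
  "symp_form n h (\<lambda>a. f a + g a) = symp_form n h f + symp_form n h g"
  "symp_form n (\<lambda>a. f a - g a) h = symp_form n f h - symp_form n g h"
  "symp_form n h (\<lambda>a. f a - g a) = symp_form n h f - symp_form n h g"
  "symp_form n (\<lambda>a. c * f a) h = c * symp_form n f h"
  "symp_form n h (\<lambda>a. c * f a) = c * symp_form n h f"
  "symp_form n (\<lambda>a. \<Sum>i\<in>I. F i a) h = (\<Sum>i\<in>I. symp_form n (F i) h)"
  "symp_form n h (\<lambda>a. \<Sum>i\<in>I. F i a) = (\<Sum>i\<in>I. symp_form n h (F i))"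
proof -
  show "symp_form n (\<lambda>a. \<Sum>i\<in>I. F i a) h = (\<Sum>i\<in>I. symp_form n (F i) h)"
    unfolding symp_form_def sum.swap[of _ _ I]
    by (simp add: sum_distrib_right sum_subtractf)
  show "symp_form n h (\<lambda>a. \<Sum>i\<in>I. F i a) = (\<Sum>i\<in>I. symp_form n h (F i))"
    unfolding symp_form_def sum.swap[of _ _ I]
    by (simp add: sum_distrib_left sum_subtractf)
qed (simp_all add: symp_form_def algebra_simps sum.distrib sum_subtractf sum_distrib_left)

lemma symp_form_skew: "symp_form n f g = - symp_form n g f"
  by (simp add: symp_form_def algebra_simps flip: sum_negf)

lemma symp_form_self [simp]: "symp_form n f f = 0"
  by (simp add: symp_form_def)

lemma symp_form_cong:
  assumes "\<And>i. i < 2 * n \<Longrightarrow> f i = f' i" and "\<And>i. i < 2 * n \<Longrightarrow> g i = g' i"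
  shows "symp_form n f g = symp_form n f' g'"
  unfolding symp_form_def by (intro sum.cong) (auto simp: assms)

lemma mat_form_linear:
  "mat_form A (\<lambda>a. f a + g a) h = mat_form A f h + mat_form A g h"
  "mat_form A h (\<lambda>a. f a + g a) = mat_form A h f + mat_form A h g"
  "mat_form A (\<lambda>a. f a - g a) h = mat_form A f h - mat_form A g h"
  "mat_form A h (\<lambda>a. f a - g a) = mat_form A h f - mat_form A h g"
  "mat_form A (\<lambda>a. c * f a) h = c * mat_form A f h"
  "mat_form A h (\<lambda>a. c * f a) = c * mat_form A h f"
  "mat_form A (\<lambda>a. \<Sum>i\<in>I. F i a) h = (\<Sum>i\<in>I. mat_form A (F i) h)"
proof -
  show "mat_form A (\<lambda>a. \<Sum>i\<in>I. F i a) h = (\<Sum>i\<in>I. mat_form A (F i) h)"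
    unfolding mat_form_def sum.swap[of _ _ I] by (simp add: sum_distrib_right)
qed (simp_all add: mat_form_def algebra_simps sum.distrib sum_subtractf sum_distrib_left)

lemma mat_form_sym:
  assumes "A \<in> carrier_mat N N" and "transpose_mat A = A"
  shows "mat_form A f g = mat_form A g f"
proof -
  have "A $$ (i, j) = A $$ (j, i)" if "i < N" "j < N" for i j
    using assms that by (metis carrier_matD index_transpose_mat(1))
  then show ?thesis
    using assms(1) unfolding mat_form_def
    by (subst sum.swap) (auto intro!: sum.cong simp: mult_ac)
qed

lemma mat_form_cong:
  assumes "A \<in> carrier_mat N N"
    and "\<And>i. i < N \<Longrightarrow> f i = f' i" and "\<And>i. i < N \<Longrightarrow> g i = g' i"
  shows "mat_form A f g = mat_form A f' g'"
  using assms unfolding mat_form_def by (auto intro!: sum.cong)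

lemma mat_form_scalar_prod:
  assumes "A \<in> carrier_mat N N"
  shows "mat_form A f g = vec N f \<bullet> (A *\<^sub>v vec N g)"
  using assms
  by (auto simp: mat_form_def scalar_prod_def lessThan_atLeast0 sum_distrib_left mult_ac
      intro!: sum.cong)

text \<open>Being nonzero is expressed by a coordinate below \<open>N\<close>, because a function
  supported beyond \<open>N\<close> represents the zero vector.\<close>

lemma mat_form_pos:
  assumes "pos_def_mat N A" and "i < N" and "f i \<noteq> 0"
  shows "mat_form A f f > 0"
proof -
  have "vec N f \<noteq> 0\<^sub>v N"
    using assms(2,3) by (metis index_vec index_zero_vec(1))
  then show ?thesis
    using assms(1) by (auto simp: pos_def_mat_def mat_form_scalar_prod)
qed

text \<open>The bridge from matrix products to forms: every congruence below is evaluated on the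
  columns of \<open>X\<close> through this identity.\<close>

lemma mat_form_congruence_index:
  assumes "A \<in> carrier_mat N N" and "X \<in> carrier_mat N m" and "i < m" and "j < m"
  shows "(transpose_mat X * A * X) $$ (i, j) = mat_form A (\<lambda>a. X $$ (a, i)) (\<lambda>a. X $$ (a, j))"
  using assms
  by (auto simp: mat_form_def scalar_prod_def lessThan_atLeast0 sum_distrib_left mult_ac
      intro!: sum.cong)

section \<open>The matrix J and the symplectic form\<close>

lemma J_mat_carrier [simp]: "J_mat n \<in> carrier_mat (2 * n) (2 * n)"
  by (simp add: J_mat_def mult_2)

lemma J_mat_dim [simp]: "dim_row (J_mat n) = 2 * n" "dim_col (J_mat n) = 2 * n"
  by (simp_all add: J_mat_def)

lemma J_mat_index:
  assumes "i < 2 * n" and "j < 2 * n"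
  shows "J_mat n $$ (i, j) = (if i < n then if j = n + i then 1 else 0
                              else if i = n + j then -1 else 0)"
  using assms by (auto simp: J_mat_def)

lemma sum_lessThan_double:
  fixes f :: "nat \<Rightarrow> real"
  shows "(\<Sum>i<2 * n. f i) = (\<Sum>i<n. f i) + (\<Sum>i<n. f (n + i))"
  using sum.nat_group[of f n 2] sum.union_disjoint[of "{..<n}" "{n..<n + n}" f]
    sum.shift_bounds_nat_ivl[of f 0 n n]
  by (simp add: mult_2 lessThan_atLeast0 ivl_disj_un ivl_disj_int add.commute)

text \<open>Lets \<open>mat_form_congruence_index\<close> express the entries of X^T J X as values
  of \<omega> = \<open>symp_form n\<close> on the columns of X.\<close>

lemma mat_form_J: "mat_form (J_mat n) f g = symp_form n f g"
proof -
  have "(\<Sum>j<2 * n. f i * J_mat n $$ (i, j) * g j) = f i * g (n + i)" if "i < n" for i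
  proof -
    have "(\<Sum>j<2 * n. f i * J_mat n $$ (i, j) * g j)
        = (\<Sum>j<2 * n. if j = n + i then f i * g j else 0)"
      using that by (intro sum.cong) (auto simp: J_mat_index)
    then show ?thesis using that by simp
  qed
  moreover have "(\<Sum>j<2 * n. f (n + i) * J_mat n $$ (n + i, j) * g j) = - f (n + i) * g i"
    if "i < n" for i
  proof -
    have "(\<Sum>j<2 * n. f (n + i) * J_mat n $$ (n + i, j) * g j)
        = (\<Sum>j<2 * n. if j = i then - f (n + i) * g j else 0)"
      using that by (intro sum.cong) (auto simp: J_mat_index)
    then show ?thesis using that by simp
  qed
  ultimately show ?thesis
    by (simp add: mat_form_def symp_form_def sum_lessThan_double sum_negf sum_subtractf)
qed

section \<open>Symplectic systems\<close>

text \<open>The x and y form a symplectic basis of their span; written as columns of X, the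
  condition reads X^T J X = J. The values \<omega>(y, x) follow by skew symmetry.\<close>

definition symp_sys :: "nat \<Rightarrow> nat \<Rightarrow> (nat \<Rightarrow> nat \<Rightarrow> real) \<Rightarrow> (nat \<Rightarrow> nat \<Rightarrow> real) \<Rightarrow> bool" where
  "symp_sys n k x y \<longleftrightarrow> (\<forall>i<k. \<forall>j<k. symp_form n (x i) (x j) = 0 \<and> symp_form n (y i) (y j) = 0 \<and>
     symp_form n (x i) (y j) = (if i = j then 1 else 0))"

definition symp_compl ::
    "nat \<Rightarrow> nat \<Rightarrow> (nat \<Rightarrow> nat \<Rightarrow> real) \<Rightarrow> (nat \<Rightarrow> nat \<Rightarrow> real) \<Rightarrow> (nat \<Rightarrow> real) set" where
  "symp_compl n k x y = {z. \<forall>i<k. symp_form n z (x i) = 0 \<and> symp_form n z (y i) = 0}"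

lemma symp_compl_linear:
  assumes "f \<in> symp_compl n k x y" and "g \<in> symp_compl n k x y"
  shows "(\<lambda>a. f a + g a) \<in> symp_compl n k x y"
    and "(\<lambda>a. f a - g a) \<in> symp_compl n k x y"
  using assms by (auto simp: symp_compl_def symp_form_linear)

lemma symp_compl_scale:
  assumes "f \<in> symp_compl n k x y"
  shows "(\<lambda>a. c * f a) \<in> symp_compl n k x y"
  using assms by (auto simp: symp_compl_def symp_form_linear)

lemma symp_sys_extend_pair:
  assumes "symp_sys n k x y" and "u \<in> symp_compl n k x y" and "v \<in> symp_compl n k x y"
    and "symp_form n u v = 1"
  shows "symp_sys n (Suc k) (x(k := u)) (y(k := v))"
  using assms symp_form_skew[of n "x _" u] symp_form_skew[of n "x _" v]
    symp_form_skew[of n "y _" u] symp_form_skew[of n "y _" v]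
  by (auto simp: symp_sys_def symp_compl_def less_Suc_eq)

text \<open>The space splits into the span of the pairs and its symplectic complement. Pairing with
  \<open>y i\<close> reads off the coefficient of \<open>x i\<close>, pairing with
  \<open>x i\<close> reads off minus that of \<open>y i\<close>; p is \<open>w\<close> with this
  expansion subtracted.\<close>

lemma symp_compl_project:
  assumes "symp_sys n k x y"
  obtains p where "p \<in> symp_compl n k x y"
    and "w = (\<lambda>a. p a + ((\<Sum>i<k. symp_form n w (y i) * x i a) - (\<Sum>i<k. symp_form n w (x i) * y i a)))"
proof -
  define p where "p = (\<lambda>a. w a - ((\<Sum>i<k. symp_form n w (y i) * x i a)
                                  - (\<Sum>i<k. symp_form n w (x i) * y i a)))"
  have yx: "symp_form n (y i) (x j) = (if i = j then -1 else 0)" if "i < k" "j < k" for i j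
    using assms that symp_form_skew[of n "y i" "x j"] by (auto simp: symp_sys_def)
  have "symp_form n p (x j) = 0 \<and> symp_form n p (y j) = 0" if "j < k" for j
  proof -
    have "(\<Sum>i<k. symp_form n w (y i) * symp_form n (x i) (x j)) = 0"
      "(\<Sum>i<k. symp_form n w (x i) * symp_form n (y i) (y j)) = 0"
      using assms that by (auto simp: symp_sys_def)
    moreover have "(\<Sum>i<k. symp_form n w (x i) * symp_form n (y i) (x j)) = - symp_form n w (x j)"
    proof -
      have "(\<Sum>i<k. symp_form n w (x i) * symp_form n (y i) (x j))
          = (\<Sum>i<k. if i = j then - symp_form n w (x i) else 0)"
        using that by (intro sum.cong) (auto simp: yx)
      then show ?thesis using that by simp
    qed
    moreover have "(\<Sum>i<k. symp_form n w (y i) * symp_form n (x i) (y j)) = symp_form n w (y j)"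
    proof -
      have "(\<Sum>i<k. symp_form n w (y i) * symp_form n (x i) (y j))
          = (\<Sum>i<k. if i = j then symp_form n w (y i) else 0)"
        using that assms by (intro sum.cong) (auto simp: symp_sys_def)
      then show ?thesis using that by simp
    qed
    ultimately show ?thesis by (simp add: p_def symp_form_linear)
  qed
  then have "p \<in> symp_compl n k x y" by (simp add: symp_compl_def)
  then show ?thesis by (rule that) (simp add: p_def)
qed

text \<open>The form pairs coordinate \<open>i\<close> with its partner \<open>n + i\<close> or
  \<open>i - n\<close>, so the unit vector at the partner recovers \<open>z i\<close> up to
  sign.\<close>

lemma symp_form_nondegenerate:
  assumes "i < 2 * n" and "z i \<noteq> 0"
  obtains w where "symp_form n z w \<noteq> 0"
proof (cases "i < n")
  case True
  have "symp_form n z (\<lambda>a. if a = n + i then 1 else 0) = (\<Sum>j<n. if j = i then z j else 0)"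
    using True unfolding symp_form_def by (intro sum.cong) auto
  then have "symp_form n z (\<lambda>a. if a = n + i then 1 else 0) \<noteq> 0"
    using True assms by simp
  then show ?thesis by (rule that)
next
  case False
  have "symp_form n z (\<lambda>a. if a = i - n then 1 else 0)
      = (\<Sum>j<n. if j = i - n then - z (n + j) else 0)"
    using False assms(1) unfolding symp_form_def by (intro sum.cong) auto
  then have "symp_form n z (\<lambda>a. if a = i - n then 1 else 0) \<noteq> 0"
    using False assms by (auto simp: less_diff_conv2)
  then show ?thesis by (rule that)
qed

text \<open>Membership amounts to \<open>2 * k\<close> linear equations in \<open>2 * n\<close>
  unknowns. Padded with zero rows, the coefficient matrix becomes square and singular, and a kernel
  vector is the required element.\<close>

lemma symp_compl_nontrivial:
  assumes "k < n"
  obtains z i where "z \<in> symp_compl n k x y" and "i < 2 * n" and "z i \<noteq> 0"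
proof -
  \<comment> \<open>\<open>r f\<close> is the coefficient row of the functional z \<mapsto>
    \<omega>(z, f).\<close>
  define r :: "(nat \<Rightarrow> real) \<Rightarrow> real vec"
    where "r f = vec (2 * n) (\<lambda>j. if j < n then f (n + j) else - f (j - n))" for f
  define R where "R i = (if i < k then r (x i) else if i < 2 * k then r (y (i - k)) else 0\<^sub>v (2 * n))" for i
  define C where "C = mat\<^sub>r (2 * n) (2 * n) R"
  have R: "R i \<in> carrier_vec (2 * n)" for i by (simp add: R_def r_def)
  \<comment> \<open>By k < n there are at least two padding rows; rows \<open>2 * k\<close> and
    \<open>2 * k + 1\<close> are both zero, hence identical.\<close>
  have "det C = 0"
    by (rule det_identical_rows[of _ "2 * n" "2 * k" "2 * k + 1"])
      (use assms R in \<open>auto simp: C_def R_def\<close>)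
  moreover have C: "C \<in> carrier_mat (2 * n) (2 * n)" by (simp add: C_def)
  ultimately obtain v where v: "v \<in> carrier_vec (2 * n)" "v \<noteq> 0\<^sub>v (2 * n)" "C *\<^sub>v v = 0\<^sub>v (2 * n)"
    using det_0_iff_vec_prod_zero by blast
  have rf: "r f \<bullet> v = symp_form n (\<lambda>i. v $ i) f" for f
  proof -
    have "r f \<bullet> v = (\<Sum>j<2 * n. r f $ j * v $ j)"
      using v(1) by (simp add: scalar_prod_def lessThan_atLeast0)
    then show ?thesis
      by (simp add: sum_lessThan_double r_def symp_form_def mult.commute[of "f _"]
          sum_subtractf sum_negf)
  qed
  have z: "R i \<bullet> v = 0" if "i < 2 * n" for i
  proof -
    have "R i \<bullet> v = (C *\<^sub>v v) $ i" using that R by (simp add: C_def)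
    then show ?thesis using v(3) that by simp
  qed
  have "(\<lambda>i. v $ i) \<in> symp_compl n k x y"
    unfolding symp_compl_def
  proof (intro CollectI allI impI)
    fix i assume "i < k"
    then show "symp_form n (($) v) (x i) = 0 \<and> symp_form n (($) v) (y i) = 0"
      using z[of i] z[of "k + i"] assms by (simp add: R_def rf)
  qed
  moreover obtain i where "i < 2 * n" "v $ i \<noteq> 0"
    using v(1,2) by (metis carrier_vecD eq_vecI index_zero_vec)
  ultimately show ?thesis using that by blast
qed

text \<open>The form stays nondegenerate on the complement: a vector w with \<omega>(z, w) nonzero
  can be replaced by its projection p, since z pairs to zero with every removed term. Rescaling p
  gives the value 1.\<close>

lemma symp_compl_pair:
  assumes "symp_sys n k x y" and "k < n"
  obtains u v where "u \<in> symp_compl n k x y" and "v \<in> symp_compl n k x y" and "symp_form n u v = 1"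
proof -
  obtain z i where z: "z \<in> symp_compl n k x y" "i < 2 * n" "z i \<noteq> 0"
    using symp_compl_nontrivial[OF assms(2)] .
  obtain w where w: "symp_form n z w \<noteq> 0"
    using symp_form_nondegenerate[where z = z, OF z(2,3)] .
  obtain p where p: "p \<in> symp_compl n k x y"
    and wp: "w = (\<lambda>a. p a + ((\<Sum>i<k. symp_form n w (y i) * x i a) - (\<Sum>i<k. symp_form n w (x i) * y i a)))"
    using symp_compl_project[OF assms(1)] .
  have "symp_form n z w = symp_form n z p"
    using z(1) by (subst wp) (simp add: symp_form_linear symp_compl_def)
  then have "symp_form n z (\<lambda>a. 1 / symp_form n z p * p a) = 1"
    using w by (simp only: symp_form_linear) simp
  then show ?thesis using that z(1) symp_compl_scale[OF p] by blast
qed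

text \<open>Symplectic Gram-Schmidt: normalized pairs from the current complement are appended until
  there are \<open>n\<close>.\<close>

lemma symp_sys_extend:
  assumes "symp_sys n k x y" and "k \<le> n"
  obtains x' y' where "symp_sys n n x' y'" and "\<And>i. i < k \<Longrightarrow> x' i = x i" and "\<And>i. i < k \<Longrightarrow> y' i = y i"
proof -
  have "\<exists>x' y'. symp_sys n n x' y' \<and> (\<forall>i<k. x' i = x i \<and> y' i = y i)"
    using assms(2,1)
  proof (induction k arbitrary: x y rule: inc_induct)
    case base
    then show ?case by blast
  next
    case (step m)
    obtain u v where "u \<in> symp_compl n m x y" "v \<in> symp_compl n m x y" "symp_form n u v = 1"
      using symp_compl_pair[OF step.prems step.hyps(2)] .
    then obtain x' y' where "symp_sys n n x' y'"
      "\<forall>i<Suc m. x' i = (x(m := u)) i \<and> y' i = (y(m := v)) i"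
      using step.IH[OF symp_sys_extend_pair[OF step.prems]] by blast
    then show ?case by (intro exI[of _ x'] exI[of _ y']) auto
  qed
  then show ?thesis using that by blast
qed

section \<open>Symplectic eigenpairs\<close>

text \<open>Tychonoff's theorem for a countable power of a compact interval.\<close>

lemma compact_unit_cube: "compact {f :: nat \<Rightarrow> real. \<forall>i. f i \<in> {-1..1}}"
proof -
  have "compactin (product_topology (\<lambda>i::nat. euclidean :: real topology) UNIV)
      (PiE UNIV (\<lambda>i. {-1..1}))"
    by (subst compactin_PiE) (simp add: compactin_euclidean_iff)
  moreover have "PiE UNIV (\<lambda>i. {-1..1}) = {f :: nat \<Rightarrow> real. \<forall>i. f i \<in> {-1..1}}"
    by (auto simp: PiE_def Pi_def)
  ultimately show ?thesis
    by (simp add: euclidean_product_topology compactin_euclidean_iff)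
qed

lemma continuous_on_symp_form [continuous_intros]:
  assumes "continuous_on S f" and "continuous_on S g"
  shows "continuous_on S (\<lambda>p. symp_form n (f p) (g p))"
  unfolding symp_form_def
  by (intro continuous_intros assms[THEN continuous_on_product_then_coordinatewise])

lemma continuous_on_mat_form [continuous_intros]:
  assumes "continuous_on S f" and "continuous_on S g"
  shows "continuous_on S (\<lambda>p. mat_form A (f p) (g p))"
  unfolding mat_form_def
  by (intro continuous_intros assms[THEN continuous_on_product_then_coordinatewise])

text \<open>The sphere constrains only the coordinates below \<open>2 * n\<close>; the cube bounds
  the remaining ones as well, which makes the set compact.\<close>

definition unit_symp_compl ::
    "nat \<Rightarrow> nat \<Rightarrow> (nat \<Rightarrow> nat \<Rightarrow> real) \<Rightarrow> (nat \<Rightarrow> nat \<Rightarrow> real) \<Rightarrow> (nat \<Rightarrow> real) set" where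
  "unit_symp_compl n k x y =
     {f. \<forall>i. f i \<in> {-1..1}} \<inter> {f. (\<Sum>i<2 * n. (f i)\<^sup>2) = 1} \<inter> symp_compl n k x y"

lemma compact_unit_symp_compl: "compact (unit_symp_compl n k x y)"
proof -
  have "closed {f :: nat \<Rightarrow> real. (\<Sum>i<2 * n. (f i)\<^sup>2) = 1}"
    by (intro closed_Collect_eq continuous_intros continuous_on_product_coordinates)
  moreover have "closed (symp_compl n k x y)"
    unfolding symp_compl_def
    by (intro closed_Collect_all closed_Collect_imp closed_Collect_conj closed_Collect_eq
        continuous_intros open_Collect_const)
  ultimately show ?thesis
    unfolding unit_symp_compl_def by (intro compact_Int_closed compact_unit_cube)
qed

lemma normalize_symp_compl:
  assumes f: "f \<in> symp_compl n k x y" and "i < 2 * n" and "f i \<noteq> 0"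
  obtains c g where "g \<in> unit_symp_compl n k x y" and "c > 0" and "\<And>j. j < 2 * n \<Longrightarrow> f j = c * g j"
proof -
  define c where "c = sqrt (\<Sum>j<2 * n. (f j)\<^sup>2)"
  \<comment> \<open>The value 0 from \<open>2 * n\<close> on keeps g in the cube and is invisible to
    the forms.\<close>
  define g where "g j = (if j < 2 * n then f j / c else 0)" for j
  have pos: "(\<Sum>j<2 * n. (f j)\<^sup>2) > 0"
    using assms(2,3) by (intro sum_pos2[of _ i]) auto
  then have c: "c > 0" "c\<^sup>2 = (\<Sum>j<2 * n. (f j)\<^sup>2)" by (simp_all add: c_def)
  have sum: "(\<Sum>j<2 * n. (g j)\<^sup>2) = 1"
    using c pos by (simp add: g_def power_divide flip: sum_divide_distrib)
  have "\<bar>g j\<bar> \<le> 1" for j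
  proof (cases "j < 2 * n")
    case True
    then have "(g j)\<^sup>2 \<le> 1"
      using member_le_sum[of j "{..<2 * n}" "\<lambda>j. (g j)\<^sup>2"] sum by simp
    then show ?thesis by (simp add: abs_square_le_1)
  qed (simp add: g_def)
  then have cube: "\<forall>j. g j \<in> {-1..1}" by (simp add: abs_le_iff minus_le_iff)
  have fg: "f j = c * g j" if "j < 2 * n" for j
    using that c(1) by (simp add: g_def)
  have "symp_form n g h = 1 / c * symp_form n f h" for h
  proof -
    have "symp_form n g h = symp_form n (\<lambda>j. 1 / c * f j) h"
      by (rule symp_form_cong) (simp_all add: g_def)
    then show ?thesis by (simp only: symp_form_linear)
  qed
  then have "g \<in> symp_compl n k x y" using f by (simp add: symp_compl_def)
  then have "g \<in> unit_symp_compl n k x y" using sum cube by (simp add: unit_symp_compl_def)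
  then show ?thesis using that c(1) fg by blast
qed

text \<open>The ratio is continuous on the compact set of unit pairs and invariant under scaling, so
  its maximum there is one over the whole complement. The cross-multiplied inequality makes sense
  also for vectors that vanish below \<open>2 * n\<close>.\<close>

lemma symp_ratio_max:
  assumes A: "pos_def_mat (2 * n) A" and sys: "symp_sys n k x y" and "k < n"
  obtains u v where "u \<in> symp_compl n k x y" and "v \<in> symp_compl n k x y" and "symp_form n u v \<noteq> 0"
    and "\<And>u' v'. u' \<in> symp_compl n k x y \<Longrightarrow> v' \<in> symp_compl n k x y \<Longrightarrow>
      (symp_form n u' v')\<^sup>2 * (mat_form A u u * mat_form A v v)
        \<le> (symp_form n u v)\<^sup>2 * (mat_form A u' u' * mat_form A v' v')"
proof -
  let ?U = "symp_compl n k x y" and ?S = "unit_symp_compl n k x y"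
  let ?w = "symp_form n" and ?q = "\<lambda>f. mat_form A f f"
  let ?F = "\<lambda>p. (?w (fst p) (snd p))\<^sup>2 / (?q (fst p) * ?q (snd p))"
  have Acar: "A \<in> carrier_mat (2 * n) (2 * n)" using A by (simp add: pos_def_mat_def)
  have qpos: "?q f > 0" if "f \<in> ?S" for f
  proof -
    have "\<exists>i<2 * n. f i \<noteq> 0"
    proof (rule ccontr)
      assume "\<not> ?thesis"
      then have "(\<Sum>i<2 * n. (f i)\<^sup>2) = 0" by simp
      then show False using that by (simp add: unit_symp_compl_def)
    qed
    then show ?thesis using mat_form_pos[OF A] by blast
  qed
  \<comment> \<open>This pair serves twice: it shows that the unit set is nonempty, and later that
    the maximal ratio is not zero.\<close>
  obtain u0 v0 where uv0: "u0 \<in> ?U" "v0 \<in> ?U" "?w u0 v0 = 1"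
    using symp_compl_pair[OF sys \<open>k < n\<close>] .
  have scale: "\<exists>a>0. \<exists>f\<in>?S. ?q f' = a\<^sup>2 * ?q f \<and> (\<forall>j<2 * n. f' j = a * f j)"
    if f': "f' \<in> ?U" "i < 2 * n" "f' i \<noteq> 0" for f' i
  proof -
    obtain c g where g: "g \<in> ?S" "c > 0" "\<And>j. j < 2 * n \<Longrightarrow> f' j = c * g j"
      using normalize_symp_compl[where f = f', OF f'] by blast
    have "?q f' = mat_form A (\<lambda>j. c * g j) (\<lambda>j. c * g j)"
      by (rule mat_form_cong[OF Acar]) (simp_all add: g(3))
    then have "?q f' = c\<^sup>2 * ?q g" by (simp add: mat_form_linear power2_eq_square)
    then show ?thesis using g by blast
  qed
  have zero: "?w f g = 0 \<and> ?w g f = 0" if "\<And>i. i < 2 * n \<Longrightarrow> f i = 0" for f g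
    using that by (simp add: symp_form_def)
  have "\<exists>i<2 * n. u0 i \<noteq> 0" using zero[of u0 v0] uv0(3) by fastforce
  then have "?S \<noteq> {}" using scale uv0(1) by blast
  moreover have "compact (?S \<times> ?S)" by (intro compact_Times compact_unit_symp_compl)
  moreover have "continuous_on (?S \<times> ?S) ?F"
  proof (intro continuous_intros)
    show "\<forall>p\<in>?S \<times> ?S. ?q (fst p) * ?q (snd p) \<noteq> 0"
      using qpos by (fastforce simp: less_imp_neq)
  qed
  ultimately have "\<exists>p\<in>?S \<times> ?S. \<forall>q\<in>?S \<times> ?S. ?F q \<le> ?F p"
    by (intro continuous_attains_sup) auto
  then obtain u v where uv: "u \<in> ?S" "v \<in> ?S" and max: "\<forall>q\<in>?S \<times> ?S. ?F q \<le> ?F (u, v)"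
    by blast
  have U: "u \<in> ?U" "v \<in> ?U" using uv by (simp_all add: unit_symp_compl_def)
  have le: "(?w f' g')\<^sup>2 * (?q u * ?q v) \<le> (?w u v)\<^sup>2 * (?q f' * ?q g')"
    if fg': "f' \<in> ?U" "g' \<in> ?U" for f' g'
  proof (cases "(\<exists>i<2 * n. f' i \<noteq> 0) \<and> (\<exists>i<2 * n. g' i \<noteq> 0)")
    case True
    obtain a f where f: "f \<in> ?S" "?q f' = a\<^sup>2 * ?q f" "\<forall>j<2 * n. f' j = a * f j" "a > 0"
      using scale[OF fg'(1)] True by blast
    obtain b g where g: "g \<in> ?S" "?q g' = b\<^sup>2 * ?q g" "\<forall>j<2 * n. g' j = b * g j" "b > 0"
      using scale[OF fg'(2)] True by blast
    have "?w f' g' = ?w (\<lambda>j. a * f j) (\<lambda>j. b * g j)"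
      by (rule symp_form_cong) (simp_all add: f(3) g(3))
    then have "?w f' g' = a * b * ?w f g" by (simp add: symp_form_linear)
    moreover have "(?w f g)\<^sup>2 * (?q u * ?q v) \<le> (?w u v)\<^sup>2 * (?q f * ?q g)"
      using bspec[OF max, of "(f, g)"] f(1) g(1) uv qpos by (simp add: field_simps)
    then have "(a * b)\<^sup>2 * ((?w f g)\<^sup>2 * (?q u * ?q v)) \<le> (a * b)\<^sup>2 * ((?w u v)\<^sup>2 * (?q f * ?q g))"
      by (rule mult_left_mono) simp
    ultimately show ?thesis using f(2) g(2) by (simp add: power_mult_distrib mult_ac)
  next
    \<comment> \<open>One of the vectors vanishes below \<open>2 * n\<close>: the left side is 0 and
      the right side is nonnegative.\<close>
    case False
    then have "?w f' g' = 0" using zero[of f' g'] zero[of g' f'] by blast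
    moreover have "?q h \<ge> 0" for h
      using mat_form_pos[OF A, of _ h] mat_form_cong[OF Acar, of h "\<lambda>_. 0" h "\<lambda>_. 0"]
      by (force simp: mat_form_def)
    ultimately show ?thesis by simp
  qed
  have "?w u v \<noteq> 0"
  proof
    assume "?w u v = 0"
    then have "?q u * ?q v \<le> 0" using le[OF uv0(1,2)] uv0(3) by simp
    then show False using qpos[OF uv(1)] qpos[OF uv(2)] by (simp add: mult_le_0_iff)
  qed
  then show ?thesis using that U le by blast
qed

text \<open>The difference of the two sides is b t + c t^2, with maximum 0 at t = 0, so the linear
  coefficient b = 2 \<mu> w \<alpha> must vanish.\<close>

lemma quadratic_first_order_zero:
  fixes \<mu> \<alpha> \<beta> w :: real
  assumes "\<mu> \<noteq> 0" and "\<alpha> > 0" and le: "\<And>t. (\<mu> + t * w)\<^sup>2 * \<alpha> \<le> \<mu>\<^sup>2 * (\<alpha> + t\<^sup>2 * \<beta>)"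
  shows "w = 0"
proof (rule ccontr)
  assume "w \<noteq> 0"
  define b where "b = 2 * \<mu> * w * \<alpha>"
  define c where "c = w\<^sup>2 * \<alpha> - \<mu>\<^sup>2 * \<beta>"
  \<comment> \<open>At the test point t = b / m the difference equals b^2 (m + c) / m^2; this m
    makes both m and m + c positive.\<close>
  define m where "m = \<bar>c\<bar> + 1"
  have m: "m > 0" "m + c > 0" by (auto simp: m_def)
  have "b * t + c * t\<^sup>2 \<le> 0" for t
    using le[of t] by (simp add: b_def c_def power2_eq_square algebra_simps)
  then have "b * (b / m) + c * (b / m)\<^sup>2 \<le> 0" .
  moreover have "b * (b / m) + c * (b / m)\<^sup>2 = b\<^sup>2 * (m + c) / m\<^sup>2"
    using m(1) by (simp add: power2_eq_square field_simps)
  moreover have "b \<noteq> 0" using assms(1,2) \<open>w \<noteq> 0\<close> by (simp add: b_def)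
  ultimately show False using m by (simp add: divide_le_0_iff mult_le_0_iff)
qed

text \<open>Perturb u along h, the part of z that is A-orthogonal to u. Then A(u + t h, u + t h) has
  no term linear in t, so maximality forces \<omega>(h, v) = 0; inserting h = z - c u gives the
  identity.\<close>

lemma ratio_max_critical:
  assumes A: "A \<in> carrier_mat (2 * n) (2 * n)" "transpose_mat A = A"
    and U: "u \<in> symp_compl n k x y" "v \<in> symp_compl n k x y" "z \<in> symp_compl n k x y"
    and \<mu>: "symp_form n u v \<noteq> 0" and pos: "mat_form A u u > 0" "mat_form A v v > 0"
    and max: "\<And>u' v'. u' \<in> symp_compl n k x y \<Longrightarrow> v' \<in> symp_compl n k x y \<Longrightarrow>
      (symp_form n u' v')\<^sup>2 * (mat_form A u u * mat_form A v v)
        \<le> (symp_form n u v)\<^sup>2 * (mat_form A u' u' * mat_form A v' v')"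
  shows "symp_form n z v = mat_form A z u * symp_form n u v / mat_form A u u"
proof -
  define c where "c = mat_form A z u / mat_form A u u"
  define h where "h = (\<lambda>a. z a - c * u a)"
  have hU: "h \<in> symp_compl n k x y"
    unfolding h_def using U by (intro symp_compl_linear symp_compl_scale)
  have hu: "mat_form A h u = 0" using pos(1) unfolding h_def mat_form_linear by (simp add: c_def)
  then have uh: "mat_form A u h = 0" using mat_form_sym[OF A] by metis
  have "symp_form n h v = 0"
  proof (rule quadratic_first_order_zero[OF \<mu> pos(1)])
    fix t
    have "(\<lambda>a. u a + t * h a) \<in> symp_compl n k x y"
      using U hU by (intro symp_compl_linear symp_compl_scale)
    from max[OF this U(2)] hu uh
    have "((symp_form n u v + t * symp_form n h v)\<^sup>2 * mat_form A u u) * mat_form A v v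
       \<le> ((symp_form n u v)\<^sup>2 * (mat_form A u u + t\<^sup>2 * mat_form A h h)) * mat_form A v v"
      by (simp add: symp_form_linear mat_form_linear power2_eq_square mult_ac)
    then show "(symp_form n u v + t * symp_form n h v)\<^sup>2 * mat_form A u u
       \<le> (symp_form n u v)\<^sup>2 * (mat_form A u u + t\<^sup>2 * mat_form A h h)"
      using pos(2) by (simp only: mult_le_cancel_right_pos)
  qed
  then show ?thesis unfolding h_def symp_form_linear by (simp add: c_def)
qed

text \<open>The critical conditions in u and in v are the two eigenpair equations up to factors, and
  rescaling u and v makes both factors equal to d.\<close>

lemma symp_eigenpair:
  assumes pd: "pos_def_mat (2 * n) A" and sys: "symp_sys n k x y" and "k < n"
  obtains u v d where "u \<in> symp_compl n k x y" and "v \<in> symp_compl n k x y" and "symp_form n u v = 1"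
    and "d > 0"
    and "\<And>z. z \<in> symp_compl n k x y \<Longrightarrow>
      mat_form A z u = d * symp_form n z v \<and> mat_form A z v = - d * symp_form n z u"
proof -
  let ?U = "symp_compl n k x y" and ?w = "symp_form n" and ?q = "\<lambda>f. mat_form A f f"
  have A: "A \<in> carrier_mat (2 * n) (2 * n)" "transpose_mat A = A"
    using pd by (simp_all add: pos_def_mat_def)
  obtain u v where U: "u \<in> ?U" "v \<in> ?U" and \<mu>: "?w u v \<noteq> 0"
    and max: "\<And>u' v'. u' \<in> ?U \<Longrightarrow> v' \<in> ?U \<Longrightarrow>
      (?w u' v')\<^sup>2 * (?q u * ?q v) \<le> (?w u v)\<^sup>2 * (?q u' * ?q v')"
    using symp_ratio_max[OF assms] by blast
  have "\<exists>i<2 * n. f i \<noteq> 0" if "?w f g \<noteq> 0 \<or> ?w g f \<noteq> 0" for f g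
    using that by (rule contrapos_pp) (simp add: symp_form_def)
  then have pos: "?q u > 0" "?q v > 0" using mat_form_pos[OF pd] \<mu> by blast+
  \<comment> \<open>The sign s makes the form of the scaled pair positive. Requiring A(u', u') =
    A(v', v') = d and \<omega>(u', v') = 1 forces d = \<alpha> \<beta> / |\<omega>(u, v)|.\<close>
  define s where "s = sgn (?w u v)"
  define \<alpha> where "\<alpha> = sqrt (?q u)"
  define \<beta> where "\<beta> = sqrt (?q v)"
  define d where "d = \<alpha> * \<beta> / \<bar>?w u v\<bar>"
  define r where "r = sqrt d"
  have ab: "\<alpha> > 0" "\<beta> > 0" "?q u = \<alpha> * \<alpha>" "?q v = \<beta> * \<beta>" using pos by (simp_all add: \<alpha>_def \<beta>_def)
  then have d: "d > 0" using \<mu> by (simp add: d_def)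
  then have r: "r > 0" "r * r = d" by (simp_all add: r_def)
  have s: "s * s = 1" "?w u v = s * \<bar>?w u v\<bar>" using \<mu> by (simp_all add: s_def sgn_if)
  have mu: "?w u v = s * (\<alpha> * \<beta> / d)" using s(2) ab by (simp add: d_def)
  define u' where "u' = (\<lambda>a. (r / \<alpha>) * u a)"
  define v' where "v' = (\<lambda>a. (s * r / \<beta>) * v a)"
  have "?w u' v' = 1"
    unfolding u'_def v'_def symp_form_linear mu using ab d s(1) r by (simp add: field_simps)
  moreover have "mat_form A z u' = d * ?w z v' \<and> mat_form A z v' = - d * ?w z u'" if z: "z \<in> ?U" for z
  proof -
    have "?w z v = mat_form A z u * ?w u v / ?q u"
      by (rule ratio_max_critical[OF A U z \<mu> pos max])
    then have "mat_form A z u * (s * \<beta>) = d * \<alpha> * ?w z v"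
      using ab d by (simp add: mu field_simps)
    then have "mat_form A z u * (s * s) * \<beta> = d * \<alpha> * (s * ?w z v)" by (simp add: mult_ac)
    then have 1: "mat_form A z u * \<beta> = d * \<alpha> * (s * ?w z v)" using s(1) by simp
    \<comment> \<open>The same criterion with u and v exchanged; the sign change of \<omega>(v, u)
      disappears in the square.\<close>
    have "?w z u = mat_form A z v * ?w v u / ?q v"
    proof (rule ratio_max_critical[OF A U(2,1) z _ pos(2,1)])
      show "?w v u \<noteq> 0" using \<mu> symp_form_skew[of n v u] by simp
      fix f g assume "f \<in> ?U" "g \<in> ?U"
      then show "(?w f g)\<^sup>2 * (?q v * ?q u) \<le> (?w v u)\<^sup>2 * (?q f * ?q g)"
        using max[of f g] symp_form_skew[of n v u] by (simp add: mult_ac)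
    qed
    then have 2: "s * mat_form A z v * \<alpha> = - d * \<beta> * ?w z u"
      using ab d symp_form_skew[of n v u] by (simp add: mu field_simps)
    have "\<alpha> * (r * (s * mat_form A z v)) = r * (s * mat_form A z v * \<alpha>)" by (simp only: mult_ac)
    also have "\<dots> = - (\<beta> * (d * (r * ?w z u)))" by (simp add: 2)
    finally show ?thesis
      unfolding u'_def v'_def symp_form_linear mat_form_linear using 1 ab by (simp add: field_simps)
  qed
  moreover have "u' \<in> ?U" "v' \<in> ?U"
    unfolding u'_def v'_def using U by (simp_all only: symp_compl_scale)
  ultimately show ?thesis using that d by blast
qed

text \<open>A new pair satisfies the eigenpair equations at first only against z in the complement.
  They extend to all z because the earlier pairs are both \<omega>-orthogonal and A-orthogonal to
  the complement, so only the projection of z contributes to either side.\<close>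

lemma symp_eigensystem:
  assumes pd: "pos_def_mat (2 * n) A" and "k \<le> n"
  shows "\<exists>x y d. symp_sys n k x y \<and> (\<forall>i<k. d i > 0 \<and>
    (\<forall>z. mat_form A z (x i) = d i * symp_form n z (y i) \<and>
         mat_form A z (y i) = - d i * symp_form n z (x i)))"
  using assms(2)
proof (induction k)
  case 0
  then show ?case by (simp add: symp_sys_def)
next
  case (Suc k)
  let ?w = "symp_form n"
  from Suc obtain x y and d :: "nat \<Rightarrow> real" where sys: "symp_sys n k x y"
    and d: "\<And>i. i < k \<Longrightarrow> d i > 0"
    and eig: "\<And>i z. i < k \<Longrightarrow> mat_form A z (x i) = d i * ?w z (y i)"
      "\<And>i z. i < k \<Longrightarrow> mat_form A z (y i) = - d i * ?w z (x i)"
    by (metis Suc_leD)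
  obtain u v e where U: "u \<in> symp_compl n k x y" "v \<in> symp_compl n k x y" and uv: "?w u v = 1" and "e > 0"
    and crit: "\<And>z. z \<in> symp_compl n k x y \<Longrightarrow>
      mat_form A z u = e * ?w z v \<and> mat_form A z v = - e * ?w z u"
    using symp_eigenpair[OF pd sys] Suc.prems by (metis Suc_le_eq)
  have A: "A \<in> carrier_mat (2 * n) (2 * n)" "transpose_mat A = A"
    using pd by (simp_all add: pos_def_mat_def)
  \<comment> \<open>A-orthogonality comes from the eigenpair equations: A(f, x_i) = d_i \<omega>(f,
    y_i) = 0, and likewise for y_i.\<close>
  have perp: "mat_form A (x i) f = 0 \<and> mat_form A (y i) f = 0 \<and> ?w (x i) f = 0 \<and> ?w (y i) f = 0"
    if "i < k" "f \<in> symp_compl n k x y" for i f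
    using that eig[OF that(1), of f] mat_form_sym[OF A, of f] symp_form_skew[of n _ f]
    by (simp add: symp_compl_def)
  have "mat_form A z u = e * ?w z v \<and> mat_form A z v = - e * ?w z u" for z
  proof -
    obtain p where p: "p \<in> symp_compl n k x y"
      and z: "z = (\<lambda>a. p a + ((\<Sum>i<k. ?w z (y i) * x i a) - (\<Sum>i<k. ?w z (x i) * y i a)))"
      using symp_compl_project[OF sys] .
    have "mat_form A z f = mat_form A p f \<and> ?w z f = ?w p f" if "f \<in> symp_compl n k x y" for f
      using arg_cong[OF z, of "\<lambda>h. mat_form A h f"] arg_cong[OF z, of "\<lambda>h. ?w h f"]
      by (simp add: mat_form_linear symp_form_linear perp that)
    then show ?thesis using crit[OF p] U by simp
  qed
  then have "symp_sys n (Suc k) (x(k := u)) (y(k := v)) \<and> (\<forall>i<Suc k. (d(k := e)) i > 0 \<and>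
      (\<forall>z. mat_form A z ((x(k := u)) i) = (d(k := e)) i * ?w z ((y(k := v)) i) \<and>
           mat_form A z ((y(k := v)) i) = - (d(k := e)) i * ?w z ((x(k := u)) i)))"
    using symp_sys_extend_pair[OF sys U uv] d eig \<open>e > 0\<close> by (auto simp: less_Suc_eq)
  then show ?case by (intro exI)
qed

section \<open>Symplectic matrices and Williamson forms\<close>

lemma congruence_congruence:
  fixes A :: "real mat"
  assumes "A \<in> carrier_mat N N" and "X \<in> carrier_mat N m" and "Y \<in> carrier_mat m l"
  shows "transpose_mat (X * Y) * A * (X * Y) = transpose_mat Y * (transpose_mat X * A * X) * Y"
proof -
  let ?P = "transpose_mat X" and ?Q = "transpose_mat Y"
  have Q: "?Q \<in> carrier_mat l m" and P: "?P \<in> carrier_mat m N" using assms by simp_all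
  have PA: "?P * A \<in> carrier_mat m N" using P assms(1) by (rule mult_carrier_mat)
  have XY: "X * Y \<in> carrier_mat N l" using assms(2,3) by (rule mult_carrier_mat)
  have PAX: "?P * A * X \<in> carrier_mat m m" using PA assms(2) by (rule mult_carrier_mat)
  have "transpose_mat (X * Y) * A * (X * Y) = ?Q * ?P * A * (X * Y)"
    using transpose_mult[OF assms(2,3)] by simp
  also have "\<dots> = ?Q * (?P * A * X * Y)"
    using assoc_mult_mat[OF Q P assms(1)] assoc_mult_mat[OF Q PA XY]
      assoc_mult_mat[OF PA assms(2,3)] by simp
  also have "\<dots> = ?Q * (?P * A * X) * Y"
    by (rule assoc_mult_mat[OF Q PAX assms(3), symmetric])
  finally show ?thesis .
qed

lemma congruence_one:
  fixes A :: "real mat"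
  assumes "A \<in> carrier_mat N N"
  shows "transpose_mat (1\<^sub>m N) * A * 1\<^sub>m N = A"
  using assms by simp

lemma J_mat_square: "J_mat n * J_mat n = - 1\<^sub>m (2 * n)"
proof -
  have "J_mat n * J_mat n = four_block_mat (- 1\<^sub>m n) (0\<^sub>m n n) (0\<^sub>m n n) (- 1\<^sub>m n)"
    unfolding J_mat_def by (subst mult_four_block_mat[of _ n n _ n _ n _ _ n _ n]) auto
  also have "\<dots> = - 1\<^sub>m (2 * n)"
    by (intro eq_matI) auto
  finally show ?thesis .
qed

lemma symplectic_mat_one: "symplectic_mat n (1\<^sub>m (2 * n))"
  by (simp add: symplectic_mat_def congruence_one[OF J_mat_carrier])

lemma symplectic_mat_mult:
  assumes "symplectic_mat n V" and "symplectic_mat n W"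
  shows "symplectic_mat n (V * W)"
  using assms congruence_congruence[OF J_mat_carrier, of V n "2 * n" W "2 * n"]
  by (auto simp: symplectic_mat_def)

text \<open>Multiplying W^T J W = J by J from the left and using J^2 = -I shows that -J W^T J is a
  left inverse of W, hence a right inverse, the matrices being square.\<close>

lemma symplectic_mat_inverse_eq:
  assumes "symplectic_mat n W"
  shows "W * - (J_mat n * transpose_mat W * J_mat n) = 1\<^sub>m (2 * n)"
proof (rule mat_mult_left_right_inverse)
  let ?J = "J_mat n" and ?N = "2 * n"
  have W: "W \<in> carrier_mat ?N ?N" "transpose_mat W * ?J * W = ?J" and T: "transpose_mat W \<in> carrier_mat ?N ?N"
    using assms by (auto simp: symplectic_mat_def)
  note J = J_mat_carrier[of n]
  show "- (?J * transpose_mat W * ?J) \<in> carrier_mat ?N ?N"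
    using mult_carrier_mat[OF mult_carrier_mat[OF J T] J] by simp
  have "?J * transpose_mat W * ?J * W = ?J * (transpose_mat W * ?J * W)"
    using J T W(1) by (simp add: assoc_mult_mat[of _ ?N ?N _ ?N _ ?N])
  then have "?J * transpose_mat W * ?J * W = - 1\<^sub>m ?N"
    by (simp only: W(2) J_mat_square)
  then show "- (?J * transpose_mat W * ?J) * W = 1\<^sub>m ?N"
    using J T W(1) by (simp del: assoc_mult_mat)
qed (use assms in \<open>simp add: symplectic_mat_def\<close>)

lemma symplectic_mat_inverse:
  assumes "symplectic_mat n W"
  obtains V where "symplectic_mat n V" and "V * W = 1\<^sub>m (2 * n)" and "W * V = 1\<^sub>m (2 * n)"
proof -
  define V where "V = - (J_mat n * transpose_mat W * J_mat n)"
  have W: "W \<in> carrier_mat (2 * n) (2 * n)" "transpose_mat W * J_mat n * W = J_mat n"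
    using assms by (auto simp: symplectic_mat_def)
  have V: "V \<in> carrier_mat (2 * n) (2 * n)" 
    using W(1) by (simp add: V_def mult_carrier_mat[of _ "2 * n" "2 * n"])
  have WV: "W * V = 1\<^sub>m (2 * n)" unfolding V_def by (rule symplectic_mat_inverse_eq[OF assms])
  then have VW: "V * W = 1\<^sub>m (2 * n)" by (rule mat_mult_left_right_inverse[OF W(1) V])
  \<comment> \<open>J = (W V)^T J (W V) = V^T (W^T J W) V = V^T J V.\<close>
  have "transpose_mat V * J_mat n * V = J_mat n"
    using congruence_congruence[OF J_mat_carrier W(1) V] congruence_one[OF J_mat_carrier, of n]
    by (simp only: WV W(2))
  then have "symplectic_mat n V" using V by (simp add: symplectic_mat_def)
  then show ?thesis using VW WV by (rule that)
qed

text \<open>The inverse formula gives W (J W^T J) = -I; multiplying by J from the right leaves W J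
  W^T = J.\<close>

lemma symplectic_mat_transpose:
  assumes "symplectic_mat n W"
  shows "symplectic_mat n (transpose_mat W)"
proof -
  let ?J = "J_mat n" and ?N = "2 * n"
  have W: "W \<in> carrier_mat ?N ?N" and T: "transpose_mat W \<in> carrier_mat ?N ?N"
    using assms by (auto simp: symplectic_mat_def)
  note J = J_mat_carrier[of n]
  have JT: "?J * transpose_mat W \<in> carrier_mat ?N ?N" using J T by (rule mult_carrier_mat)
  have WJT: "W * ?J * transpose_mat W \<in> carrier_mat ?N ?N" 
    by (intro mult_carrier_mat[of _ ?N ?N] W T J)
  have "W * (?J * transpose_mat W * ?J) = - 1\<^sub>m ?N"
    using symplectic_mat_inverse_eq[OF assms] W T J
    by (metis mult_carrier_mat uminus_mult_right_mat uminus_uminus_mat carrier_matD)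
  then have "W * ?J * transpose_mat W * ?J = - 1\<^sub>m ?N"
    by (simp only: assoc_mult_mat[OF W JT J] assoc_mult_mat[OF W J T])
  then have "W * ?J * transpose_mat W * ?J * ?J = - 1\<^sub>m ?N * ?J" by simp
  moreover have "W * ?J * transpose_mat W * ?J * ?J = W * ?J * transpose_mat W * (?J * ?J)"
    by (rule assoc_mult_mat[OF WJT J J])
  moreover have "\<dots> = - (W * ?J * transpose_mat W)"
    using WJT unfolding J_mat_square
    by (metis carrier_matD(2) index_one_mat(2) right_mult_one_mat uminus_mult_right_mat)
  moreover have "- 1\<^sub>m ?N * ?J = - ?J"
    using J by (metis carrier_matD(1) index_one_mat(3) left_mult_one_mat uminus_mult_left_mat)
  ultimately have "W * ?J * transpose_mat W = ?J" by (metis uminus_uminus_mat)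
  then show ?thesis using W by (simp add: symplectic_mat_def)
qed

text \<open>A comparison of the four blocks entry by entry; the lower left one follows from the
  upper right one by skew symmetry.\<close>

lemma symp_sys_iff:
  assumes "X \<in> carrier_mat (2 * n) (2 * k)"
  shows "transpose_mat X * J_mat n * X = J_mat k
    \<longleftrightarrow> symp_sys n k (\<lambda>i a. X $$ (a, i)) (\<lambda>i a. X $$ (a, k + i))"
    (is "?L = ?R")
proof -
  let ?w = "\<lambda>i j. symp_form n (\<lambda>a. X $$ (a, i)) (\<lambda>a. X $$ (a, j))"
  have X: "transpose_mat X * J_mat n * X \<in> carrier_mat (2 * k) (2 * k)"
    using assms by (simp add: mult_carrier_mat[of _ _ "2 * n"])
  have w: "(transpose_mat X * J_mat n * X) $$ (i, j) = ?w i j" if "i < 2 * k" "j < 2 * k" for i j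
    using mat_form_congruence_index[OF J_mat_carrier assms that] by (simp add: mat_form_J)
  have "?L \<longleftrightarrow> (\<forall>i<2 * k. \<forall>j<2 * k. ?w i j = J_mat k $$ (i, j))"
  proof
    assume "\<forall>i<2 * k. \<forall>j<2 * k. ?w i j = J_mat k $$ (i, j)"
    then show ?L using X J_mat_carrier[of k] w by (intro eq_matI) auto
  qed (use w in auto)
  also have "\<dots> \<longleftrightarrow> ?R"
  proof
    assume *: "\<forall>i<2 * k. \<forall>j<2 * k. ?w i j = J_mat k $$ (i, j)"
    then show ?R unfolding symp_sys_def by (auto simp: J_mat_index)
  next
    assume *: ?R
    show "\<forall>i<2 * k. \<forall>j<2 * k. ?w i j = J_mat k $$ (i, j)"
    proof (intro allI impI)
      fix i j assume ij: "i < 2 * k" "j < 2 * k"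
      have yx: "?w (k + a) b = (if a = b then -1 else 0)" if "a < k" "b < k" for a b
        using * that symp_form_skew[of n "\<lambda>c. X $$ (c, k + a)"] by (auto simp: symp_sys_def)
      consider "i < k" "j < k" | "i < k" "j - k < k" "j = k + (j - k)"
        | "i - k < k" "i = k + (i - k)" "j < k"
        | "i - k < k" "i = k + (i - k)" "j - k < k" "j = k + (j - k)"
        using ij by linarith
      then show "?w i j = J_mat k $$ (i, j)"
      proof cases
        case 1
        then show ?thesis using * ij by (simp add: symp_sys_def J_mat_index)
      next
        case 2
        have "?w i (k + (j - k)) = (if i = j - k then 1 else 0)"
          using * 2(1,2) by (auto simp: symp_sys_def)
        then show ?thesis using 2 ij by (auto simp: J_mat_index)
      next
        case 3
        then show ?thesis using yx[of "i - k" j] ij by (auto simp: J_mat_index)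
      next
        case 4
        have "?w (k + (i - k)) (k + (j - k)) = 0"
          using * 4(1,3) by (auto simp: symp_sys_def)
        then show ?thesis using 4 ij by (auto simp: J_mat_index)
      qed
    qed
  qed
  finally show ?thesis .
qed

section \<open>Matrices assembled from symplectic pairs\<close>

definition cols_mat :: "nat \<Rightarrow> nat \<Rightarrow> (nat \<Rightarrow> nat \<Rightarrow> real) \<Rightarrow> (nat \<Rightarrow> nat \<Rightarrow> real) \<Rightarrow> real mat" where
  "cols_mat n k x y = mat (2 * n) (2 * k) (\<lambda>(a, i). if i < k then x i a else y (i - k) a)"

lemma cols_mat_carrier [simp]: "cols_mat n k x y \<in> carrier_mat (2 * n) (2 * k)"
  by (simp add: cols_mat_def)

lemma cols_mat_index:
  assumes "a < 2 * n" and "i < k"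
  shows "cols_mat n k x y $$ (a, i) = x i a" and "cols_mat n k x y $$ (a, k + i) = y i a"
  using assms by (simp_all add: cols_mat_def)

lemma cols_mat_J:
  "transpose_mat (cols_mat n k x y) * J_mat n * cols_mat n k x y = J_mat k \<longleftrightarrow> symp_sys n k x y"
proof -
  let ?X = "cols_mat n k x y"
  have "symp_form n (\<lambda>a. ?X $$ (a, i)) (\<lambda>a. ?X $$ (a, j)) = symp_form n (x i) (x j)"
    "symp_form n (\<lambda>a. ?X $$ (a, k + i)) (\<lambda>a. ?X $$ (a, k + j)) = symp_form n (y i) (y j)"
    "symp_form n (\<lambda>a. ?X $$ (a, i)) (\<lambda>a. ?X $$ (a, k + j)) = symp_form n (x i) (y j)"
    if "i < k" "j < k" for i j
    using that by (auto intro!: symp_form_cong simp: cols_mat_index)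
  then show ?thesis
    unfolding symp_sys_iff[OF cols_mat_carrier] by (simp add: symp_sys_def)
qed

lemma cols_mat_congruence_index:
  assumes "A \<in> carrier_mat (2 * n) (2 * n)" and "i < k" and "j < k"
  shows "(transpose_mat (cols_mat n k x y) * A * cols_mat n k x y) $$ (i, j) = mat_form A (x i) (x j)"
    and "(transpose_mat (cols_mat n k x y) * A * cols_mat n k x y) $$ (i, k + j) = mat_form A (x i) (y j)"
    and "(transpose_mat (cols_mat n k x y) * A * cols_mat n k x y) $$ (k + i, j) = mat_form A (y i) (x j)"
    and "(transpose_mat (cols_mat n k x y) * A * cols_mat n k x y) $$ (k + i, k + j) = mat_form A (y i) (y j)"
  using assms
  by (auto simp: mat_form_congruence_index[OF assms(1) cols_mat_carrier] cols_mat_index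
      intro!: mat_form_cong[OF assms(1)])

lemma pos_def_mat_congruence:
  assumes "pos_def_mat (2 * n) A" and "symplectic_mat n S"
  shows "pos_def_mat (2 * n) (transpose_mat S * A * S)"
proof -
  let ?N = "2 * n"
  have A: "A \<in> carrier_mat ?N ?N" "transpose_mat A = A"
    and S: "S \<in> carrier_mat ?N ?N" "transpose_mat S \<in> carrier_mat ?N ?N"
    using assms by (auto simp: pos_def_mat_def symplectic_mat_def)
  obtain V where V: "symplectic_mat n V" "V * S = 1\<^sub>m ?N"
    using symplectic_mat_inverse[OF assms(2)] by blast
  have "transpose_mat (transpose_mat S * A * S) = transpose_mat S * A * S"
    using A S by (simp add: transpose_mult[of _ ?N ?N _ ?N])
  moreover have "v \<bullet> ((transpose_mat S * A * S) *\<^sub>v v) > 0" if v: "v \<in> carrier_vec ?N" "v \<noteq> 0\<^sub>v ?N" for v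
  proof -
    have "V *\<^sub>v (S *\<^sub>v v) = v"
      using V S v by (metis assoc_mult_mat_vec one_mult_mat_vec symplectic_mat_def)
    moreover have "V *\<^sub>v 0\<^sub>v ?N = 0\<^sub>v ?N"
      using V(1) by (auto simp: symplectic_mat_def)
    ultimately have "S *\<^sub>v v \<noteq> 0\<^sub>v ?N" using v(2) by metis
    then have "(S *\<^sub>v v) \<bullet> (A *\<^sub>v (S *\<^sub>v v)) > 0"
      using assms(1) S v by (simp add: pos_def_mat_def)
    moreover have "(transpose_mat S * A * S) *\<^sub>v v = transpose_mat S *\<^sub>v (A *\<^sub>v (S *\<^sub>v v))"
      using A S v by (simp add: assoc_mult_mat_vec[of _ ?N ?N _ ?N])
    moreover have "v \<bullet> (transpose_mat S *\<^sub>v (A *\<^sub>v (S *\<^sub>v v))) = (S *\<^sub>v v) \<bullet> (A *\<^sub>v (S *\<^sub>v v))"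
      using transpose_vec_mult_scalar[OF S(1) v(1), of "A *\<^sub>v (S *\<^sub>v v)"] A S v
      by (metis comm_scalar_prod mult_mat_vec_carrier)
    ultimately show ?thesis by simp
  qed
  ultimately show ?thesis using A S by (simp add: pos_def_mat_def)
qed

section \<open>Williamson forms and compressions\<close>

abbreviation double_diag :: "nat \<Rightarrow> real vec \<Rightarrow> real mat" where
  "double_diag n d \<equiv> four_block_mat (mat_diag n (\<lambda>i. d $ i)) (0\<^sub>m n n) (0\<^sub>m n n) (mat_diag n (\<lambda>i. d $ i))"

lemma double_diag_carrier: "double_diag n d \<in> carrier_mat (2 * n) (2 * n)"
  by (simp add: mult_2)

lemma double_diag_index:
  assumes "i < n" and "j < n"
  shows "double_diag n d $$ (i, j) = (if i = j then d $ i else 0)"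
    and "double_diag n d $$ (i, n + j) = 0"
    and "double_diag n d $$ (n + i, j) = 0"
    and "double_diag n d $$ (n + i, n + j) = (if i = j then d $ i else 0)"
  using assms by (auto simp: mat_diag_def)

text \<open>V is the inverse transpose of W, again symplectic. This is the shape that eigenpairs
  deliver, with the columns of V as the pairs.\<close>

lemma williamson_form_iff:
  assumes A: "A \<in> carrier_mat (2 * n) (2 * n)"
  shows "williamson_form n A d \<longleftrightarrow> d \<in> carrier_vec n \<and> (\<forall>i<n. d $ i > 0) \<and>
    (\<exists>V. symplectic_mat n V \<and> transpose_mat V * A * V = double_diag n d)"
proof -
  have "(\<exists>W. symplectic_mat n W \<and> A = W * double_diag n d * transpose_mat W)
    \<longleftrightarrow> (\<exists>V. symplectic_mat n V \<and> transpose_mat V * A * V = double_diag n d)"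
    (is "?L \<longleftrightarrow> ?R")
  proof
    assume ?L
    then obtain W where W: "symplectic_mat n W" "A = W * double_diag n d * transpose_mat W" by blast
    obtain V where V: "symplectic_mat n V" "transpose_mat W * V = 1\<^sub>m (2 * n)"
      using symplectic_mat_inverse[OF symplectic_mat_transpose[OF W(1)]] by blast
    have "transpose_mat V * A * V = double_diag n d"
      using congruence_congruence[OF double_diag_carrier, of "transpose_mat W" n "2 * n" V "2 * n" d] V W(1)
        congruence_one[OF double_diag_carrier[of n d]]
      by (simp add: symplectic_mat_def W(2))
    then show ?R using V(1) by blast
  next
    assume ?R
    then obtain V where V: "symplectic_mat n V" "transpose_mat V * A * V = double_diag n d" by blast
    obtain U where U: "symplectic_mat n U" "V * U = 1\<^sub>m (2 * n)"
      using symplectic_mat_inverse[OF V(1)] by blast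
    have "A = transpose_mat U * double_diag n d * U"
      using congruence_congruence[OF A, of V "2 * n" U "2 * n"] V U congruence_one[OF A]
      by (simp add: symplectic_mat_def)
    then show ?L using symplectic_mat_transpose[OF U(1)] by (intro exI[of _ "transpose_mat U"]) simp
  qed
  then show ?thesis by (simp add: williamson_form_def)
qed

text \<open>V diagonalizes S^T A S exactly when S V diagonalizes A, and S is invertible. As an
  equality of predicates it makes the choice in \<open>symp_eigvals\<close> return the same vector
  for both matrices.\<close>

lemma williamson_form_congruence:
  assumes A: "A \<in> carrier_mat (2 * n) (2 * n)" and S: "symplectic_mat n S"
  shows "williamson_form n (transpose_mat S * A * S) = williamson_form n A"
proof -
  have Sc: "S \<in> carrier_mat (2 * n) (2 * n)" using S by (simp add: symplectic_mat_def)
  obtain T where T: "symplectic_mat n T" "S * T = 1\<^sub>m (2 * n)"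
    using symplectic_mat_inverse[OF S] by blast
  have B: "transpose_mat S * A * S \<in> carrier_mat (2 * n) (2 * n)" using A Sc by simp
  have S_mult: "transpose_mat (S * V) * A * (S * V) = transpose_mat V * (transpose_mat S * A * S) * V"
    if "symplectic_mat n V" for V
    using that by (intro congruence_congruence[OF A Sc]) (auto simp: symplectic_mat_def)
  have ST: "S * (T * V) = V" if "symplectic_mat n V" for V
  proof -
    have "S * (T * V) = S * T * V"
      using assoc_mult_mat[OF Sc] T(1) that by (auto simp: symplectic_mat_def)
    then show ?thesis using that by (auto simp: T(2) symplectic_mat_def)
  qed
  have "(\<exists>V. symplectic_mat n V \<and> transpose_mat V * (transpose_mat S * A * S) * V = D)
    \<longleftrightarrow> (\<exists>V. symplectic_mat n V \<and> transpose_mat V * A * V = D)" for D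
    using S_mult ST symplectic_mat_mult[OF S] symplectic_mat_mult[OF T(1)] by metis
  then show ?thesis unfolding williamson_form_iff[OF A] williamson_form_iff[OF B] fun_eq_iff by simp
qed

text \<open>With a full eigensystem as the columns of V, the eigenpair equations turn each entry of
  V^T A V into plus or minus d_j times a value of \<omega> on the system.\<close>

theorem williamson:
  assumes "pos_def_mat (2 * n) A"
  shows "\<exists>d. williamson_form n A d"
proof -
  have A: "A \<in> carrier_mat (2 * n) (2 * n)" using assms by (simp add: pos_def_mat_def)
  obtain x y and d :: "nat \<Rightarrow> real" where sys: "symp_sys n n x y" and d: "\<And>i. i < n \<Longrightarrow> d i > 0"
    and eig: "\<And>i z. i < n \<Longrightarrow> mat_form A z (x i) = d i * symp_form n z (y i)"
      "\<And>i z. i < n \<Longrightarrow> mat_form A z (y i) = - d i * symp_form n z (x i)"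
    using symp_eigensystem[OF assms, of n] by blast
  let ?V = "cols_mat n n x y" and ?d = "vec n d"
  have yx: "symp_form n (y i) (x j) = (if i = j then -1 else 0)" if "i < n" "j < n" for i j
    using sys that symp_form_skew[of n "y i" "x j"] by (auto simp: symp_sys_def)
  have "transpose_mat ?V * A * ?V = double_diag n ?d"
  proof (rule eq_matI)
    fix i j assume "i < dim_row (double_diag n ?d)" "j < dim_col (double_diag n ?d)"
    then have ij: "i < 2 * n" "j < 2 * n" by (simp_all add: mat_diag_def)
    have split: "a < n \<or> (\<exists>b<n. a = n + b)" if "a < 2 * n" for a
      using that by (metis add_diff_inverse_nat mult_2 nat_add_left_cancel_less)
    note entries = cols_mat_congruence_index[OF A] double_diag_index eig yx
    from split[OF ij(1)] split[OF ij(2)]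
    show "(transpose_mat ?V * A * ?V) $$ (i, j) = double_diag n ?d $$ (i, j)"
      using sys by (elim disjE exE conjE) (simp_all add: entries symp_sys_def del: index_mat_four_block)
  qed (use A in \<open>auto simp: mat_diag_def cols_mat_def\<close>)
  moreover have "symplectic_mat n ?V"
    using sys by (simp add: symplectic_mat_def cols_mat_J)
  ultimately have "williamson_form n A ?d" using d unfolding williamson_form_iff[OF A] by auto
  then show ?thesis ..
qed

text \<open>Selecting whole symplectic pairs of columns of V keeps the relations of a symplectic
  system, injectivity of \<open>p\<close> keeping the selected pairs distinct. It is applied to a
  Williamson basis and to the identity matrix.\<close>

lemma select_columns:
  assumes V: "symplectic_mat n V" and A: "A \<in> carrier_mat (2 * n) (2 * n)"
    and p: "inj_on p {..<k}" "p ` {..<k} \<subseteq> {..<n}"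
  obtains B where "B \<in> symp_compressions n k A"
    and "\<And>j. j < k \<Longrightarrow> B $$ (j, j) = (transpose_mat V * A * V) $$ (p j, p j)"
    and "\<And>j. j < k \<Longrightarrow> B $$ (k + j, k + j) = (transpose_mat V * A * V) $$ (n + p j, n + p j)"
proof -
  let ?X = "cols_mat n k (\<lambda>i a. V $$ (a, p i)) (\<lambda>i a. V $$ (a, n + p i))"
  have Vc: "V \<in> carrier_mat (2 * n) (2 * n)" using V by (simp add: symplectic_mat_def)
  have pn: "p j < n" if "j < k" for j using p(2) that by auto
  have "symp_sys n n (\<lambda>i a. V $$ (a, i)) (\<lambda>i a. V $$ (a, n + i))"
    using V symp_sys_iff[OF Vc] by (simp add: symplectic_mat_def)
  then have "symp_sys n k (\<lambda>i a. V $$ (a, p i)) (\<lambda>i a. V $$ (a, n + p i))"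
    using pn p(1) by (auto simp: symp_sys_def inj_on_eq_iff)
  then have "transpose_mat ?X * A * ?X \<in> symp_compressions n k A"
    unfolding symp_compressions_def
    by (intro CollectI exI[of _ ?X]) (simp add: cols_mat_J)
  then show ?thesis
    by (rule that)
      (use pn in \<open>simp_all add: cols_mat_congruence_index[OF A] mat_form_congruence_index[OF A Vc] trans_less_add1 mult_2\<close>)
qed

text \<open>The columns of X are completed to \<open>n\<close> symplectic pairs. The second half
  then starts at \<open>n\<close> instead of \<open>k\<close>, so the diagonal pairs of
  \<open>B\<close> become the first \<open>k\<close> diagonal pairs of S^T A S.\<close>

lemma extend_columns:
  assumes B: "B \<in> symp_compressions n k A" and "k \<le> n" and A: "A \<in> carrier_mat (2 * n) (2 * n)"
  obtains S where "symplectic_mat n S"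
    and "\<And>j. j < k \<Longrightarrow> (transpose_mat S * A * S) $$ (j, j) = B $$ (j, j)"
    and "\<And>j. j < k \<Longrightarrow> (transpose_mat S * A * S) $$ (n + j, n + j) = B $$ (k + j, k + j)"
proof -
  obtain X where X: "X \<in> carrier_mat (2 * n) (2 * k)" "transpose_mat X * J_mat n * X = J_mat k"
    and BX: "B = transpose_mat X * A * X"
    using B unfolding symp_compressions_def by blast
  obtain x y where xy: "symp_sys n n x y" "\<And>i. i < k \<Longrightarrow> x i = (\<lambda>a. X $$ (a, i))"
    "\<And>i. i < k \<Longrightarrow> y i = (\<lambda>a. X $$ (a, k + i))"
    using symp_sys_extend[OF X(2)[unfolded symp_sys_iff[OF X(1)]] \<open>k \<le> n\<close>] by blast
  have "symplectic_mat n (cols_mat n n x y)"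
    using xy(1) by (simp add: symplectic_mat_def cols_mat_J)
  then show ?thesis
    by (rule that)
      (use xy(2,3) \<open>k \<le> n\<close> in \<open>simp_all add: cols_mat_congruence_index[OF A] BX
        mat_form_congruence_index[OF A X(1)]\<close>)
qed

section \<open>Increasing rearrangements\<close>

lemma incr_rearr_permutation:
  assumes "z \<in> carrier_vec n"
  obtains p where "p permutes {..<n}" and "\<And>i. i < n \<Longrightarrow> incr_rearr z $ i = z $ p i"
proof -
  obtain p where p: "p permutes {..<length (list_of_vec z)}" "permute_list p (list_of_vec z) = sort (list_of_vec z)"
    using mset_eq_permutation[of "sort (list_of_vec z)" "list_of_vec z"] by auto
  have "incr_rearr z $ i = z $ p i" if "i < n" for i
    using p that assms
    by (simp add: incr_rearr_def vec_of_list_index list_of_vec_index permute_list_nth flip: p(2))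
  then show ?thesis using that p(1) assms by simp
qed

lemma incr_rearr_mono:
  assumes "z \<in> carrier_vec n" and "i \<le> j" and "j < n"
  shows "incr_rearr z $ i \<le> incr_rearr z $ j"
  using assms sorted_nth_mono[of "sort (list_of_vec z)" i j]
  by (simp add: incr_rearr_def vec_of_list_index)

lemma incr_rearr_carrier:
  assumes "z \<in> carrier_vec n"
  shows "incr_rearr z \<in> carrier_vec n"
  using assms by (intro carrier_vecI) (simp add: incr_rearr_def)

lemma incr_rearr_idem: "incr_rearr (incr_rearr z) = incr_rearr z"
  by (simp add: incr_rearr_def list_vec sorted_sort_id)

text \<open>Exchange argument: the indices below \<open>k\<close> missing from \<open>T\<close> are
  as many as the elements of \<open>T\<close> from \<open>k\<close> on, and each of the former is
  smaller than each of the latter.\<close>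

lemma sum_initial_le:
  fixes w :: "nat \<Rightarrow> real"
  assumes mono: "\<And>i j. i \<le> j \<Longrightarrow> j < n \<Longrightarrow> w i \<le> w j" and T: "T \<subseteq> {..<n}" "card T = k"
  shows "(\<Sum>j<k. w j) \<le> (\<Sum>j\<in>T. w j)"
proof -
  have fin: "finite T" using T(1) finite_subset by blast
  have "card ({..<k} - T) = card (T - {..<k})"
    using fin T(2) card_Diff_subset_Int[of "{..<k}" T] card_Diff_subset_Int[of T "{..<k}"]
    by (simp add: Int_commute)
  then obtain h where h: "bij_betw h ({..<k} - T) (T - {..<k})"
    using fin by (metis finite_Diff finite_lessThan finite_same_card_bij)
  have "(\<Sum>j\<in>{..<k} - T. w j) \<le> (\<Sum>j\<in>{..<k} - T. w (h j))"
  proof (rule sum_mono)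
    fix j assume "j \<in> {..<k} - T"
    then have "h j \<in> T - {..<k}" "j < k" using h by (auto simp: bij_betw_def)
    then show "w j \<le> w (h j)" using T(1) by (intro mono) auto
  qed
  also have "\<dots> = (\<Sum>j\<in>T - {..<k}. w j)"
    by (rule sum.reindex_bij_betw[OF h])
  finally show ?thesis
    using sum.Int_Diff[of "{..<k}" w T] sum.Int_Diff[of T w "{..<k}"] fin by (simp add: Int_commute)
qed

text \<open>In the sorted vector the selected entries occupy a set \<open>T\<close> of
  \<open>k\<close> positions, found through the inverse of the sorting permutation, so
  \<open>sum_initial_le\<close> applies.\<close>

lemma sum_incr_rearr_le:
  assumes z: "z \<in> carrier_vec n" and f: "inj_on f {..<k}" "f ` {..<k} \<subseteq> {..<n}"
  shows "(\<Sum>j<k. incr_rearr z $ j) \<le> (\<Sum>j<k. z $ f j)"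
proof -
  obtain p where p: "p permutes {..<n}" and zp: "\<And>i. i < n \<Longrightarrow> incr_rearr z $ i = z $ p i"
    using incr_rearr_permutation[OF z] by blast
  let ?q = "inv_into UNIV p"
  define T where "T = ?q ` f ` {..<k}"
  have inv: "?q permutes {..<n}" using p by (rule permutes_inv)
  have inj: "inj_on (?q) X" for X
    using permutes_inj[OF inv] by (rule inj_on_subset) simp
  have T: "T \<subseteq> {..<n}" "card T = k"
  proof -
    show "T \<subseteq> {..<n}" using f(2) permutes_in_image[OF inv] by (auto simp: T_def)
    show "card T = k" using f(1) by (simp add: T_def card_image inj)
  qed
  have "(\<Sum>j<k. incr_rearr z $ j) \<le> (\<Sum>j\<in>T. incr_rearr z $ j)"
    using incr_rearr_mono[OF z] T by (intro sum_initial_le) auto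
  also have "\<dots> = (\<Sum>j<k. incr_rearr z $ ?q (f j))"
    using f(1) by (simp add: T_def sum.reindex inj)
  also have "\<dots> = (\<Sum>j<k. z $ f j)"
  proof (rule sum.cong)
    fix j assume "j \<in> {..<k}"
    then have "?q (f j) < n" using T(1) by (auto simp: T_def)
    then show "incr_rearr z $ ?q (f j) = z $ f j" using zp p by (simp add: permutes_inverses)
  qed simp
  finally show ?thesis .
qed

section \<open>Supermajorization and the minimum principle\<close>

lemma is_mean_diag:
  assumes "is_mean M" and "a > 0"
  shows "M a a = a"
proof -
  have "a \<le> M a a \<and> M a a \<le> a"
    using assms unfolding is_mean_def by blast
  then show ?thesis by simp
qed

theorem theorem5p1:
  fixes n :: nat and M :: "real \<Rightarrow> real \<Rightarrow> real"
  assumes "n \<ge> 1" and "is_mean M"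
  shows "(\<forall>A. pos_def_mat (2 * n) A \<longrightarrow>
            weak_supermajorized n (symp_diag M n A) (symp_eigvals n A))
     \<longleftrightarrow>
         (\<forall>A. pos_def_mat (2 * n) A \<longrightarrow>
            (\<forall>k \<in> {1..n}.
               is_minimum (\<Sum>j<k. symp_eigvals n A $ j)
                 {\<Sum>j<k. M (B $$ (j, j)) (B $$ (k + j, k + j)) | B.
                    B \<in> symp_compressions n k A}))"
    (is "?maj \<longleftrightarrow> ?min")
proof
  assume maj: ?maj
  show ?min
  proof (intro allI impI ballI)
    fix A k assume pd: "pos_def_mat (2 * n) A" and "k \<in> {1..n}"
    then have k: "k \<in> {1..n}" "k \<le> n" and A: "A \<in> carrier_mat (2 * n) (2 * n)"
      by (auto simp: pos_def_mat_def)
    \<comment> \<open>The very vector chosen inside \<open>symp_eigvals\<close>, so that its sorted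
      version is the eigenvalue vector by definition.\<close>
    define d where "d = (SOME d. williamson_form n A d)"
    have eigvals: "symp_eigvals n A = incr_rearr d" by (simp add: symp_eigvals_def d_def)
    have "williamson_form n A d" unfolding d_def using williamson[OF pd] by (rule someI_ex)
    then obtain V where d: "d \<in> carrier_vec n" "\<And>i. i < n \<Longrightarrow> d $ i > 0" and V: "symplectic_mat n V"
      "transpose_mat V * A * V = double_diag n d"
      unfolding williamson_form_iff[OF A] by blast
    show "is_minimum (\<Sum>j<k. symp_eigvals n A $ j)
      {\<Sum>j<k. M (B $$ (j, j)) (B $$ (k + j, k + j)) | B. B \<in> symp_compressions n k A}"
      unfolding is_minimum_def
    proof (intro conjI ballI)
      \<comment> \<open>Attainment: the first \<open>k\<close> values of the sorting permutation
        point to the pairs of columns of V with the smallest entries of d.\<close>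
      obtain p where p: "p permutes {..<n}" and dp: "\<And>i. i < n \<Longrightarrow> incr_rearr d $ i = d $ p i"
        using incr_rearr_permutation[OF d(1)] by blast
      have pn: "p j < n" if "j < k" for j using permutes_in_image[OF p, of j] k that by simp
      have "inj_on p {..<k}" using permutes_inj[OF p] by (rule inj_on_subset) simp
      then obtain B where B: "B \<in> symp_compressions n k A"
        "\<And>j. j < k \<Longrightarrow> B $$ (j, j) = double_diag n d $$ (p j, p j)"
        "\<And>j. j < k \<Longrightarrow> B $$ (k + j, k + j) = double_diag n d $$ (n + p j, n + p j)"
        using select_columns[OF V(1) A, of p k] pn unfolding V(2) by blast
      have "(\<Sum>j<k. symp_eigvals n A $ j) = (\<Sum>j<k. M (B $$ (j, j)) (B $$ (k + j, k + j)))"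
      proof (rule sum.cong)
        fix j assume "j \<in> {..<k}"
        then have "j < k" by simp
        then have "B $$ (j, j) = d $ p j" "B $$ (k + j, k + j) = d $ p j"
          using B(2,3) pn double_diag_index[of "p j" n "p j" d] by simp_all
        then show "symp_eigvals n A $ j = M (B $$ (j, j)) (B $$ (k + j, k + j))"
          using is_mean_diag[OF assms(2) d(2)] pn \<open>j < k\<close> k dp by (simp add: eigvals)
      qed simp
      then show "(\<Sum>j<k. symp_eigvals n A $ j)
          \<in> {\<Sum>j<k. M (B $$ (j, j)) (B $$ (k + j, k + j)) | B. B \<in> symp_compressions n k A}"
        using B(1) by blast
    next
      fix s assume "s \<in> {\<Sum>j<k. M (B $$ (j, j)) (B $$ (k + j, k + j)) | B. B \<in> symp_compressions n k A}"
      then obtain B where B: "B \<in> symp_compressions n k A"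
        and s: "s = (\<Sum>j<k. M (B $$ (j, j)) (B $$ (k + j, k + j)))" by blast
      \<comment> \<open>Lower bound: the compression is seen inside the full congruence S^T A S, to
        which the supermajorization hypothesis applies.\<close>
      obtain S where S: "symplectic_mat n S"
        and SB: "\<And>j. j < k \<Longrightarrow> (transpose_mat S * A * S) $$ (j, j) = B $$ (j, j)"
          "\<And>j. j < k \<Longrightarrow> (transpose_mat S * A * S) $$ (n + j, n + j) = B $$ (k + j, k + j)"
        using extend_columns[OF B k(2) A] by blast
      let ?A = "transpose_mat S * A * S"
      have "symp_eigvals n ?A = incr_rearr d"
        by (simp add: symp_eigvals_def d_def williamson_form_congruence[OF A S])
      moreover have "weak_supermajorized n (symp_diag M n ?A) (symp_eigvals n ?A)"
        using maj pos_def_mat_congruence[OF pd S] by blast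
      ultimately have "(\<Sum>j<k. incr_rearr d $ j) \<le> (\<Sum>j<k. incr_rearr (symp_diag M n ?A) $ j)"
        using k(1) by (auto simp: weak_supermajorized_def incr_rearr_idem)
      \<comment> \<open>The first \<open>k\<close> entries, in their original order, sum to at least
        the \<open>k\<close> smallest ones.\<close>
      also have "\<dots> \<le> (\<Sum>j<k. symp_diag M n ?A $ id j)"
        by (rule sum_incr_rearr_le[of _ n]) (use k in \<open>auto simp: symp_diag_def\<close>)
      also have "\<dots> = s"
        unfolding s using k SB by (intro sum.cong) (auto simp: symp_diag_def)
      finally show "(\<Sum>j<k. symp_eigvals n A $ j) \<le> s" by (simp add: eigvals)
    qed
  qed
next
  assume min: ?min
  show ?maj
  proof (intro allI impI)
    fix A assume pd: "pos_def_mat (2 * n) A"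
    then have A: "A \<in> carrier_mat (2 * n) (2 * n)" by (simp add: pos_def_mat_def)
    let ?z = "symp_diag M n A"
    have z: "?z \<in> carrier_vec n" by (simp add: symp_diag_def)
    have "williamson_form n A (SOME d. williamson_form n A d)"
      using williamson[OF pd] by (rule someI_ex)
    then have eig: "symp_eigvals n A \<in> carrier_vec n"
      by (simp add: symp_eigvals_def williamson_form_def incr_rearr_carrier)
    \<comment> \<open>Here p locates the smallest entries of the symplectic diagonal; compressing A
      to the coordinate pairs \<open>p j\<close>, \<open>n + p j\<close> realizes their sum.\<close>
    obtain p where p: "p permutes {..<n}" and zp: "\<And>i. i < n \<Longrightarrow> incr_rearr ?z $ i = ?z $ p i"
      using incr_rearr_permutation[OF z] by blast
    have "(\<Sum>j<k. incr_rearr (symp_eigvals n A) $ j) \<le> (\<Sum>j<k. incr_rearr ?z $ j)"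
      if k: "k \<in> {1..n}" for k
    proof -
      have pn: "p j < n" if "j < k" for j using permutes_in_image[OF p, of j] k that by simp
      have "inj_on p {..<k}" using permutes_inj[OF p] by (rule inj_on_subset) simp
      then obtain B where B: "B \<in> symp_compressions n k A"
        "\<And>j. j < k \<Longrightarrow> B $$ (j, j) = A $$ (p j, p j)"
        "\<And>j. j < k \<Longrightarrow> B $$ (k + j, k + j) = A $$ (n + p j, n + p j)"
        using select_columns[OF symplectic_mat_one A, of p k] pn
        unfolding congruence_one[OF A] by blast
      have "(\<Sum>j<k. symp_eigvals n A $ j) \<le> (\<Sum>j<k. M (B $$ (j, j)) (B $$ (k + j, k + j)))"
        using min pd k B(1) unfolding is_minimum_def by blast
      also have "\<dots> = (\<Sum>j<k. incr_rearr ?z $ j)"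
        using k B(2,3) pn zp by (intro sum.cong) (auto simp: symp_diag_def)
      \<comment> \<open>The eigenvalue vector is already sorted, so the rearrangement in the
        definition of supermajorization leaves it unchanged.\<close>
      finally show ?thesis
        by (simp add: symp_eigvals_def incr_rearr_idem)
    qed
    then show "weak_supermajorized n ?z (symp_eigvals n A)"
      using z eig by (simp add: weak_supermajorized_def)
  qed
qed

end
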